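(* For every integer $k\ge 2$, there exists an IRC-colorable graph $G$ with $\chi_{irc}(G)=k$.
   Context: All graphs are finite, simple, undirected and connected. Private neighbors. For $S\subseteq V(G)$ and $v\in S$, $pn[v,S]=N[v]\setminus\bigcup_{u\in S\setminus\{v\}}N[u]$, where $N[\cdot]$ is the closed neighborhood. $S$ is irredundant if $pn[v,S]\ne\emptyset$ for all $v\in S$. Rainbow committees and IRC-colorings. For a proper coloring of $G$ with nonempty color classes $V_1,\dots,V_k$, a rainbow committee is a set containing exactly one vertex of each color class. An irredundance compelling coloring (IRC-coloring) is a proper coloring in which every rainbow committee is an irredundant set. $G$ is IRC-colorable if it admits an IRC-coloring. Irredundance compelling chromatic number. For an IRC-colorable $G$, $\chi_{irc}(G)$ is the maximum number of colors used by an IRC-coloring of $G$. *)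

theory Defs
  imports "Graph_Theory.Graph_Theory"
begin

definition closed_nbhd :: "'a pair_pre_digraph \<Rightarrow> 'a \<Rightarrow> 'a set" where
  "closed_nbhd G v = insert v {u. (v, u) \<in> parcs G}"

definition private_nbrs :: "'a pair_pre_digraph \<Rightarrow> 'a \<Rightarrow> 'a set \<Rightarrow> 'a set" where
  "private_nbrs G v S = closed_nbhd G v - (\<Union>u\<in>S - {v}. closed_nbhd G u)"

definition irredundant :: "'a pair_pre_digraph \<Rightarrow> 'a set \<Rightarrow> bool" where
  "irredundant G S \<longleftrightarrow> S \<subseteq> pverts G \<and> (\<forall>v\<in>S. private_nbrs G v S \<noteq> {})"

definition color_class :: "'a pair_pre_digraph \<Rightarrow> ('a \<Rightarrow> nat) \<Rightarrow> nat \<Rightarrow> 'a set" where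
  "color_class G c i = {v \<in> pverts G. c v = i}"

text \<open>The colors are exactly \<open>1, \<dots>, k\<close>; equality (rather than inclusion) of the image
  says that all \<open>k\<close> color classes are nonempty.\<close>

definition proper_coloring :: "'a pair_pre_digraph \<Rightarrow> nat \<Rightarrow> ('a \<Rightarrow> nat) \<Rightarrow> bool" where
  "proper_coloring G k c \<longleftrightarrow>
     c ` pverts G = {1..k} \<and> (\<forall>(u, v)\<in>parcs G. c u \<noteq> c v)"

definition rainbow_committee ::
    "'a pair_pre_digraph \<Rightarrow> nat \<Rightarrow> ('a \<Rightarrow> nat) \<Rightarrow> 'a set \<Rightarrow> bool" where
  "rainbow_committee G k c S \<longleftrightarrow>
     S \<subseteq> pverts G \<and> (\<forall>i\<in>{1..k}. card (S \<inter> color_class G c i) = 1)"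

definition irc_coloring :: "'a pair_pre_digraph \<Rightarrow> nat \<Rightarrow> ('a \<Rightarrow> nat) \<Rightarrow> bool" where
  "irc_coloring G k c \<longleftrightarrow>
     proper_coloring G k c \<and> (\<forall>S. rainbow_committee G k c S \<longrightarrow> irredundant G S)"

definition irc_colorable :: "'a pair_pre_digraph \<Rightarrow> bool" where
  "irc_colorable G \<longleftrightarrow> (\<exists>k c. irc_coloring G k c)"

text \<open>For finite \<open>G\<close> the set below is finite, since \<open>k\<close> is at most the number of vertices;
  it is nonempty if \<open>G\<close> is IRC-colorable. Only then is the value of \<open>Max\<close> meaningful.\<close>

definition chi_irc :: "'a pair_pre_digraph \<Rightarrow> nat" where
  "chi_irc G = Max {k. \<exists>c. irc_coloring G k c}"

end

theory Submission
  imports Defs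
begin

text \<open>Take \<open>k - 1\<close> copies of \<open>K\<^sub>2\<^sub>,\<^sub>3\<close> and identify one vertex from each of their sides of size three.
  Upper bound: if the neighborhood of \<open>v\<close> is contained in that of \<open>u\<close>, then \<open>u\<close> and \<open>v\<close> have the same
  color in every IRC-coloring, since otherwise some rainbow committee contains \<open>u\<close>, \<open>v\<close> and a
  neighbor \<open>w\<close> of \<open>v\<close>, and \<open>u\<close> and \<open>w\<close> together dominate all of \<open>N[v]\<close>. This merges all vertices on
  the sides of size three into one color and each of the \<open>k - 1\<close> sides of size two into one color.
  Lower bound: in this coloring every vertex \<open>v\<close> has two neighbors of a common color all of whose
  neighbors have the color of \<open>v\<close>; a committee misses one of the two, and that one is a private
  neighbor of \<open>v\<close>.\<close>

section \<open>Committees and colorings of arbitrary graphs\<close>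

lemma rainbow_committee_extend:
  assumes col: "proper_coloring G k c"
    and A: "A \<subseteq> pverts G" "inj_on c A"
  obtains S where "rainbow_committee G k c S" "A \<subseteq> S"
proof -
  have im: "c ` pverts G = {1..k}"
    using col by (simp add: proper_coloring_def)
  \<comment> \<open>\<open>f\<close> chooses a representative of each color, preferring a vertex of
    \<open>A\<close>; injectivity of \<open>c\<close> on \<open>A\<close> leaves only one candidate
    there.\<close>
  define f where "f i = (if i \<in> c ` A then inv_into A c i else inv_into (pverts G) c i)" for i
  have f: "f i \<in> pverts G \<and> c (f i) = i" if "i \<in> {1..k}" for i
  proof (cases "i \<in> c ` A")
    case True
    then show ?thesis
      using A inv_into_into[OF True] f_inv_into_f[OF True] by (auto simp: f_def)
  next
    case False
    have i: "i \<in> c ` pverts G" using that im by simp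
    show ?thesis
      using False inv_into_into[OF i] f_inv_into_f[OF i] by (simp add: f_def)
  qed
  have "f ` {1..k} \<inter> color_class G c i = {f i}" if "i \<in> {1..k}" for i
    using f that by (auto simp: color_class_def)
  then have "rainbow_committee G k c (f ` {1..k})"
    using f by (auto simp: rainbow_committee_def)
  moreover have "A \<subseteq> f ` {1..k}"
  proof
    fix a assume a: "a \<in> A"
    then have "c a \<in> {1..k}" using A im by blast
    moreover have "f (c a) = a" using a A by (simp add: f_def)
    ultimately show "a \<in> f ` {1..k}" by force
  qed
  ultimately show thesis by (rule that)
qed

lemma irc_coloring_eq_if_nbhd_subset:
  assumes irc: "irc_coloring G k c"
    and vw: "(v, w) \<in> parcs G"
    and sub: "\<And>x. (v, x) \<in> parcs G \<Longrightarrow> (u, x) \<in> parcs G"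
    and V: "u \<in> pverts G" "v \<in> pverts G" "w \<in> pverts G"
    and sym: "sym (parcs G)"
  shows "c u = c v"
proof (rule ccontr)
  assume neq: "c u \<noteq> c v"
  have col: "proper_coloring G k c" using irc by (simp add: irc_coloring_def)
  \<comment> \<open>\<open>w\<close> is a common neighbor of \<open>u\<close> and \<open>v\<close>,
    so its color differs from both.\<close>
  have "c v \<noteq> c w" "c u \<noteq> c w"
    using col vw sub[OF vw] by (auto simp: proper_coloring_def)
  with neq have "inj_on c {u, v, w}" by (auto simp: inj_on_def)
  then obtain S where S: "rainbow_committee G k c S" "{u, v, w} \<subseteq> S"
    using rainbow_committee_extend[OF col] V by (metis empty_subsetI insert_subset)
  then have "private_nbrs G v S \<noteq> {}"
    using irc by (auto simp: irc_coloring_def irredundant_def)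
  \<comment> \<open>The neighbors of \<open>v\<close> are dominated by \<open>u\<close>, and
    \<open>v\<close> itself by \<open>w\<close>.\<close>
  moreover have "closed_nbhd G v \<subseteq> closed_nbhd G u \<union> closed_nbhd G w"
    using sub vw sym by (auto simp: closed_nbhd_def dest: symD)
  moreover have "u \<in> S - {v}" "w \<in> S - {v}"
    using S neq \<open>c v \<noteq> c w\<close> by auto
  ultimately show False by (auto simp: private_nbrs_def)
qed

lemma irc_coloringI_twin_nbrs:
  assumes col: "proper_coloring G k c"
    and sym: "sym (parcs G)"
    and twins: "\<And>v. v \<in> pverts G \<Longrightarrow> \<exists>w w'. w \<noteq> w' \<and> c w = c w' \<and>
      w \<in> pverts G \<and> w' \<in> pverts G \<and> (v, w) \<in> parcs G \<and> (v, w') \<in> parcs G \<and>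
      (\<forall>x. (w, x) \<in> parcs G \<or> (w', x) \<in> parcs G \<longrightarrow> c x = c v)"
  shows "irc_coloring G k c"
proof -
  have "private_nbrs G v S \<noteq> {}" if S: "rainbow_committee G k c S" and v: "v \<in> S" for S v
  proof -
    have SV: "S \<subseteq> pverts G" using S by (simp add: rainbow_committee_def)
    have unique: "a = b" if "a \<in> S" "b \<in> S" "c a = c b" for a b
    proof -
      have "c a \<in> {1..k}" using that SV col unfolding proper_coloring_def by blast
      then have "card (S \<inter> color_class G c (c a)) = 1"
        using S by (simp add: rainbow_committee_def)
      moreover have "a \<in> S \<inter> color_class G c (c a)" "b \<in> S \<inter> color_class G c (c a)"
        using that SV by (auto simp: color_class_def)
      ultimately show ?thesis by (metis card_1_singletonE singletonD)
    qed
    \<comment> \<open>The twins share a color, so \<open>S\<close> contains at most one of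
      them.\<close>
    obtain w where w: "w \<notin> S" "(v, w) \<in> parcs G" "\<And>x. (w, x) \<in> parcs G \<Longrightarrow> c x = c v"
      using twins[of v] v SV unique by (metis subsetD)
    \<comment> \<open>All neighbors of \<open>w\<close> have the color of \<open>v\<close>, and
      \<open>v\<close> is the only member of \<open>S\<close> with that color.\<close>
    have "w \<notin> closed_nbhd G u" if "u \<in> S - {v}" for u
      using that w sym unique v by (auto simp: closed_nbhd_def dest: symD)
    then have "w \<in> private_nbrs G v S"
      using w by (auto simp: private_nbrs_def closed_nbhd_def)
    then show ?thesis by blast
  qed
  then show ?thesis
    using col by (auto simp: irc_coloring_def irredundant_def rainbow_committee_def)
qed

text \<open>The \<open>i\<close>-th copy of \<open>K\<^sub>2\<^sub>,\<^sub>3\<close> has sides \<open>{4i + 1, 4i + 2}\<close> and \<open>{0, 4i + 3, 4i + 4}\<close>.\<close>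

definition bouquet_arcs :: "nat \<Rightarrow> (nat \<times> nat) set" where
  "bouquet_arcs m = (\<Union>i<m. {4 * i + 1, 4 * i + 2} \<times> {0, 4 * i + 3, 4 * i + 4})"

definition bouquet :: "nat \<Rightarrow> nat pair_pre_digraph" where
  "bouquet m = \<lparr>pverts = {..4 * m}, parcs = bouquet_arcs m \<union> (bouquet_arcs m)\<inverse>\<rparr>"

text \<open>Residues 1 and 2 modulo 4 mark the sides of size two, where \<open>v div 4\<close> is
  the index of the copy. The offset 2 keeps color 1 for all other vertices.\<close>

definition bouquet_coloring :: "nat \<Rightarrow> nat" where
  "bouquet_coloring v = (if v mod 4 \<in> {1, 2} then v div 4 + 2 else 1)"

section \<open>Adjacency and connectedness of the bouquet\<close>

lemma bouquet_simps [simp]: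
  "pverts (bouquet m) = {..4 * m}"
  "parcs (bouquet m) = bouquet_arcs m \<union> (bouquet_arcs m)\<inverse>"
  by (simp_all add: bouquet_def)

lemma sym_bouquet: "sym (parcs (bouquet m))"
  by (auto simp: sym_def)

lemma bouquet_arcsI:
  assumes "i < m" "a \<in> {4 * i + 1, 4 * i + 2}" "b \<in> {0, 4 * i + 3, 4 * i + 4}"
  shows "(a, b) \<in> parcs (bouquet m)" "(b, a) \<in> parcs (bouquet m)"
  using assms by (auto simp: bouquet_arcs_def)

lemma bouquet_arcsE:
  assumes "(u, v) \<in> parcs (bouquet m)"
  obtains i where "u \<in> {4 * i + 1, 4 * i + 2}" "v \<in> {0, 4 * i + 3, 4 * i + 4}"
  | i where "v \<in> {4 * i + 1, 4 * i + 2}" "u \<in> {0, 4 * i + 3, 4 * i + 4}"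
  using assms unfolding bouquet_simps bouquet_arcs_def by blast

lemma bouquet_vertex_cases:
  assumes "v \<in> pverts (bouquet m)"
  obtains "v = 0"
  | i where "i < m" "v \<in> {4 * i + 1, 4 * i + 2}"
  | i where "i < m" "v \<in> {4 * i + 3, 4 * i + 4}"
proof (cases "v = 0")
  case False
  \<comment> \<open>Copy \<open>i\<close> owns the labels from \<open>4 * i + 1\<close> to
    \<open>4 * i + 4\<close>, hence the shift by one before dividing.\<close>
  define i where "i = (v - 1) div 4"
  have "i < m" using False assms by (auto simp: i_def)
  moreover have "v \<in> {4 * i + 1, 4 * i + 2} \<or> v \<in> {4 * i + 3, 4 * i + 4}"
    using False unfolding i_def insert_iff empty_iff by presburger
  ultimately show thesis using that by blast
qed (use that in blast)

lemma bouquet_inner_arcs: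
  assumes "i < m" "a \<in> {4 * i + 1, 4 * i + 2}"
  shows "(a, x) \<in> parcs (bouquet m) \<longleftrightarrow> x \<in> {0, 4 * i + 3, 4 * i + 4}"
proof
  assume "(a, x) \<in> parcs (bouquet m)"
  then show "x \<in> {0, 4 * i + 3, 4 * i + 4}"
    by (rule bouquet_arcsE; use assms(2) in \<open>auto; presburger\<close>)
qed (use assms bouquet_arcsI in blast)

text \<open>The label determines the copy here. Vertex \<open>0\<close> is left out because its
  neighbors come from all copies.\<close>

lemma bouquet_outer_arcs:
  assumes "i < m" "b \<in> {4 * i + 3, 4 * i + 4}"
  shows "(b, x) \<in> parcs (bouquet m) \<longleftrightarrow> x \<in> {4 * i + 1, 4 * i + 2}"
proof
  assume "(b, x) \<in> parcs (bouquet m)"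
  then show "x \<in> {4 * i + 1, 4 * i + 2}"
    by (rule bouquet_arcsE; use assms(2) in \<open>auto; presburger\<close>)
qed (use assms bouquet_arcsI in blast)

lemma bouquet_coloring_inner: "a \<in> {4 * i + 1, 4 * i + 2} \<Longrightarrow> bouquet_coloring a = i + 2"
  by (auto simp: bouquet_coloring_def; presburger)

lemma bouquet_coloring_outer: "b \<in> {0, 4 * i + 3, 4 * i + 4} \<Longrightarrow> bouquet_coloring b = 1"
  by (auto simp: bouquet_coloring_def; presburger)

lemma pair_graph_bouquet: "pair_graph (bouquet m)"
proof
  show "finite (pverts (bouquet m))" by simp
  show "finite (parcs (bouquet m))" by (simp add: bouquet_arcs_def)
  show "symmetric (with_proj (bouquet m))"
    using sym_bouquet by (simp add: symmetric_def arcs_ends_conv arc_to_ends_def)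
qed (auto simp: bouquet_arcs_def)

lemma connected_bouquet: "connected (with_proj (bouquet m))"
proof -
  interpret pair_graph "bouquet m" by (rule pair_graph_bouquet)
  have arc: "u \<rightarrow>\<^sup>*\<^bsub>with_proj (bouquet m)\<^esub> v" if "(u, v) \<in> parcs (bouquet m)" for u v
    using that by (intro reachable_adjI) simp
  have "0 \<rightarrow>\<^sup>*\<^bsub>with_proj (bouquet m)\<^esub> v" if "v \<in> pverts (bouquet m)" for v
    using that
  proof (cases v rule: bouquet_vertex_cases)
    case 1
    then show ?thesis by (auto simp: reachable_refl)
  next
    case (2 i)
    then show ?thesis by (intro arc bouquet_arcsI(2)) auto
  next
    case (3 i)
    \<comment> \<open>Such a vertex is not adjacent to \<open>0\<close>; the path goes through the
      side of size two of its copy.\<close>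
    have "(0, 4 * i + 1) \<in> parcs (bouquet m)" "(4 * i + 1, v) \<in> parcs (bouquet m)"
      by (rule bouquet_arcsI[OF 3(1)]; use 3(2) in auto)+
    then show ?thesis by (meson arc reachable_trans)
  qed
  then have "u \<rightarrow>\<^sup>*\<^bsub>with_proj (bouquet m)\<^esub> v"
    if "u \<in> pverts (bouquet m)" "v \<in> pverts (bouquet m)" for u v
    using that symmetric_reachable[OF sym_arcs] by (meson reachable_trans)
  then show ?thesis
    unfolding connected_def by (intro strongly_connectedI reachable_mk_symmetricI) auto
qed

section \<open>Lower and upper bounds on the number of colors\<close>

lemma irc_coloring_bouquet:
  assumes "m \<ge> 1"
  shows "irc_coloring (bouquet m) (m + 1) bouquet_coloring"
proof (rule irc_coloringI_twin_nbrs)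
  have "bouquet_coloring v \<in> {1..m + 1}" if "v \<in> pverts (bouquet m)" for v
    using that
  proof (cases v rule: bouquet_vertex_cases)
    case 1
    then show ?thesis using bouquet_coloring_outer[of v] by simp
  next
    case (2 i)
    then show ?thesis using bouquet_coloring_inner[of v i] by simp
  next
    case (3 i)
    then show ?thesis using bouquet_coloring_outer[of v i] by simp
  qed
  moreover have "j \<in> bouquet_coloring ` pverts (bouquet m)" if j: "j \<in> {1..m + 1}" for j
  proof (cases "j = 1")
    case True
    then show ?thesis using bouquet_coloring_outer[of 0] by force
  next
    case False
    then have "bouquet_coloring (4 * (j - 2) + 1) = j"
      using bouquet_coloring_inner[of "4 * (j - 2) + 1" "j - 2"] j by auto
    moreover have "4 * (j - 2) + 1 \<in> pverts (bouquet m)" using j False by auto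
    ultimately show ?thesis by force
  qed
  ultimately have "bouquet_coloring ` pverts (bouquet m) = {1..m + 1}" by blast
  moreover have "bouquet_coloring u \<noteq> bouquet_coloring v" if "(u, v) \<in> parcs (bouquet m)" for u v
    using that
  proof (cases rule: bouquet_arcsE)
    case (1 i)
    then show ?thesis
      using bouquet_coloring_inner[of u i] bouquet_coloring_outer[of v i] by simp
  next
    case (2 i)
    then show ?thesis
      using bouquet_coloring_inner[of v i] bouquet_coloring_outer[of u i] by simp
  qed
  ultimately show "proper_coloring (bouquet m) (m + 1) bouquet_coloring"
    by (auto simp: proper_coloring_def)
next
  show "sym (parcs (bouquet m))" by (rule sym_bouquet)
next
  fix v assume v: "v \<in> pverts (bouquet m)"
  let ?twins = "\<lambda>w w'. w \<noteq> w' \<and> bouquet_coloring w = bouquet_coloring w' \<and>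
      w \<in> pverts (bouquet m) \<and> w' \<in> pverts (bouquet m) \<and>
      (v, w) \<in> parcs (bouquet m) \<and> (v, w') \<in> parcs (bouquet m) \<and>
      (\<forall>x. (w, x) \<in> parcs (bouquet m) \<or> (w', x) \<in> parcs (bouquet m) \<longrightarrow>
         bouquet_coloring x = bouquet_coloring v)"
  have outer: "?twins (4 * i + 1) (4 * i + 2)" if "i < m" "v \<in> {0, 4 * i + 3, 4 * i + 4}" for i
    using that bouquet_inner_arcs[of i m] bouquet_arcsI(2)[of i m] bouquet_coloring_inner[of _ i]
      bouquet_coloring_outer[of _ i] by (auto simp del: bouquet_simps(2))
  from v show "\<exists>w w'. ?twins w w'"
  proof (cases v rule: bouquet_vertex_cases)
    case 1
    \<comment> \<open>Any copy would serve for vertex \<open>0\<close>; \<open>m \<ge> 1\<close>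
      guarantees that copy \<open>0\<close> exists.\<close>
    show ?thesis by (intro exI, rule outer[of 0]) (use 1 assms in auto)
  next
    case (2 i)
    \<comment> \<open>Vertex \<open>0\<close> is avoided as a twin: with several copies its
      neighbors have several colors.\<close>
    then have "?twins (4 * i + 3) (4 * i + 4)"
      using bouquet_outer_arcs[of i m] bouquet_arcsI(1)[of i m] bouquet_coloring_inner[of _ i]
        bouquet_coloring_outer[of _ i] by (auto simp del: bouquet_simps(2))
    then show ?thesis by (intro exI)
  next
    case (3 i)
    show ?thesis by (intro exI, rule outer[of i]) (use 3 in auto)
  qed
qed

lemma irc_coloring_bouquet_le:
  assumes irc: "irc_coloring (bouquet m) k c"
  shows "k \<le> m + 1"
proof -
  have outer: "c v = c 0" if "i < m" "v \<in> {4 * i + 3, 4 * i + 4}" for i v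
  \<comment> \<open>The larger neighborhood is that of \<open>0\<close>, so \<open>0\<close> takes
    the role of \<open>u\<close>; this fixes the direction of the equation.\<close>
  proof (rule sym, rule irc_coloring_eq_if_nbhd_subset[OF irc _ _ _ _ _ sym_bouquet])
    show "(v, 4 * i + 1) \<in> parcs (bouquet m)"
      using that by (intro bouquet_arcsI(2)[of i]) auto
    show "(0, x) \<in> parcs (bouquet m)" if "(v, x) \<in> parcs (bouquet m)" for x
      using that \<open>i < m\<close> \<open>v \<in> _\<close> bouquet_outer_arcs bouquet_arcsI(2) by blast
  qed (use that in auto)
  have inner: "c (4 * i + 2) = c (4 * i + 1)" if "i < m" for i
  proof (rule irc_coloring_eq_if_nbhd_subset[OF irc _ _ _ _ _ sym_bouquet])
    show "(4 * i + 1, 0) \<in> parcs (bouquet m)"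
      using that by (intro bouquet_arcsI(1)[of i]) auto
    show "(4 * i + 2, x) \<in> parcs (bouquet m)" if "(4 * i + 1, x) \<in> parcs (bouquet m)" for x
      using that \<open>i < m\<close> bouquet_inner_arcs by blast
  qed (use that in auto)
  have "c v \<in> insert (c 0) ((\<lambda>i. c (4 * i + 1)) ` {..<m})" if "v \<in> pverts (bouquet m)" for v
    using that by (cases v rule: bouquet_vertex_cases) (use outer inner in auto)
  then have "c ` pverts (bouquet m) \<subseteq> insert (c 0) ((\<lambda>i. c (4 * i + 1)) ` {..<m})"
    by blast
  moreover have "c ` pverts (bouquet m) = {1..k}"
    using irc by (simp add: irc_coloring_def proper_coloring_def)
  ultimately have "{1..k} \<subseteq> insert (c 0) ((\<lambda>i. c (4 * i + 1)) ` {..<m})"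
    by simp
  then have "card {1..k} \<le> card (insert (c 0) ((\<lambda>i. c (4 * i + 1)) ` {..<m}))"
    by (intro card_mono) auto
  also have "\<dots> \<le> Suc (card ((\<lambda>i. c (4 * i + 1)) ` {..<m}))"
    by (simp add: card_insert_if)
  also have "\<dots> \<le> Suc m"
    using card_image_le[of "{..<m}" "\<lambda>i. c (4 * i + 1)"] by simp
  finally show ?thesis by simp
qed

theorem theorem7:
  fixes k :: nat
  assumes "k \<ge> 2"
  shows "\<exists>G :: nat pair_pre_digraph.
           pair_graph G \<and> connected (with_proj G) \<and> irc_colorable G \<and> chi_irc G = k"
proof -
  \<comment> \<open>One color per copy plus the common color makes \<open>k\<close>;
    \<open>k \<ge> 2\<close> ensures at least one copy.\<close>
  define G where "G = bouquet (k - 1)"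
  have col: "irc_coloring G k bouquet_coloring"
    using irc_coloring_bouquet[of "k - 1"] assms by (simp add: G_def)
  have le: "l \<le> k" if "irc_coloring G l c" for l c
    using irc_coloring_bouquet_le[of "k - 1" l c] that assms by (simp add: G_def)
  \<comment> \<open>The upper bound also yields the finiteness that makes \<open>Max\<close>
    meaningful.\<close>
  have "finite {l. \<exists>c. irc_coloring G l c}"
    by (rule finite_subset[of _ "{..k}"]) (use le in auto)
  then have "chi_irc G = k"
    unfolding chi_irc_def by (rule Max_eqI) (use le col in auto)
  moreover have "irc_colorable G" using col by (auto simp: irc_colorable_def)
  ultimately show ?thesis
    using pair_graph_bouquet connected_bouquet by (auto simp: G_def)
qed

end
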